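(* Let $m\ge 1$, $a\ge 3$, $n\ge 2$ be integers and let $J=(x_1^{am},\ldots,x_n^{am})(x_1^m,\ldots,x_n^m)\subset S=K[x_1,\ldots,x_n]$. Then for every integer $k\ge 1$, $$s(J^k)=\begin{cases} ma(k+n-1)-n, & \text{if } k\le (n-1)(a-1);\\ m(ak+k+n-1)-n, & \text{if } k\ge (n-1)(a-1).\end{cases}$$
   Context: $K$ is a field and $S=K[x_1,\ldots,x_n]$ is standard graded. For a graded ideal $H\subset S$ with $\dim(S/H)=0$, $s(H)$ denotes the largest integer $i$ such that $(S/H)_i\neq 0$ (the socle degree of $S/H$). *)

theory Defs
  imports
    "HOL-Algebra.Algebra"
    "HOL-Algebra.Algebraic_Closure_Type"
    "HOL-Library.Poly_Mapping"
    "HOL-Library.Cardinality"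
    "HOL-Library.Extended_Real"
begin

text \<open>
  \<open>K[x\<^sub>1, \<dots>, x\<^sub>n]\<close>: the variables are indexed by a finite type \<open>'n\<close>, so \<open>n = CARD('n)\<close>. A monomial
  is its exponent vector in \<open>'n \<Rightarrow>\<^sub>0 nat\<close>, and a polynomial is a finitely supported function from
  monomials to \<open>'k\<close>; the multiplication of such functions in \<^theory>\<open>HOL-Library.Poly_Mapping\<close> is the
  convolution product.
\<close>

type_synonym ('n, 'k) mpol = "('n \<Rightarrow>\<^sub>0 nat) \<Rightarrow>\<^sub>0 'k"

abbreviation mpol_ring :: "('n::finite, 'k::field) mpol ring" where
  "mpol_ring \<equiv> ring_of_type_algebra"

definition Var :: "'n::finite \<Rightarrow> ('n, 'k::field) mpol" where
  "Var i = Poly_Mapping.single (Poly_Mapping.single i 1) 1"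

definition mon_degree :: "('n::finite \<Rightarrow>\<^sub>0 nat) \<Rightarrow> nat" where
  "mon_degree t = (\<Sum>i\<in>UNIV. Poly_Mapping.lookup t i)"

definition graded_part :: "nat \<Rightarrow> ('n::finite, 'k::field) mpol set" where
  "graded_part d = {f. \<forall>t\<in>Poly_Mapping.keys f. mon_degree t = d}"

definition graded_ideal :: "('n::finite, 'k::field) mpol set \<Rightarrow> bool" where
  "graded_ideal H \<longleftrightarrow> ideal H mpol_ring \<and> H = Idl\<^bsub>mpol_ring\<^esub> (\<Union>d. H \<inter> graded_part d)"

text \<open>
  The supremum is taken in \<^typ>\<open>ereal\<close> so that the zero ring, which has no prime ideals, gets
  dimension \<open>-\<infinity>\<close> and not \<open>0\<close>.
\<close>

definition krull_dim :: "('a, 'b) ring_scheme \<Rightarrow> ereal" where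
  "krull_dim R = Sup {ereal (real l) | l. \<exists>P :: nat \<Rightarrow> 'a set.
     (\<forall>i\<le>l. primeideal (P i) R) \<and> (\<forall>i<l. P i \<subset> P (Suc i))}"

text \<open>\<open>(S/H)\<^sub>d\<close>, the image of \<open>S\<^sub>d\<close> in \<open>S/H\<close>.\<close>

definition quot_graded_part ::
    "('n::finite, 'k::field) mpol set \<Rightarrow> nat \<Rightarrow> ('n, 'k) mpol set set" where
  "quot_graded_part H d = (\<lambda>f. H +>\<^bsub>mpol_ring\<^esub> f) ` graded_part d"

text \<open>
  Only meaningful for graded \<open>H\<close> with \<open>dim (S/H) = 0\<close>: otherwise there need not be a greatest such
  \<open>d\<close>, and the value is unspecified.
\<close>

definition socle_degree :: "('n::finite, 'k::field) mpol set \<Rightarrow> nat" where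
  "socle_degree H =
     (GREATEST d. quot_graded_part H d \<noteq> {\<zero>\<^bsub>mpol_ring Quot H\<^esub>})"

abbreviation ideal_power :: "('a, 'b) ring_scheme \<Rightarrow> 'a set \<Rightarrow> nat \<Rightarrow> 'a set" where
  "ideal_power R I k \<equiv> I [^]\<^bsub>ideals_set R\<^esub> k"

definition var_power_ideal :: "nat \<Rightarrow> ('n::finite, 'k::field) mpol set" where
  "var_power_ideal e = Idl\<^bsub>mpol_ring\<^esub> (range (\<lambda>i. Var i [^]\<^bsub>mpol_ring\<^esub> e))"

end

theory Submission
  imports Defs
begin

text \<open>
  \<open>J\<^sup>k\<close> is the monomial ideal generated by the \<open>x\<^bsup>m(au+v)\<^esup>\<close> with \<open>|u| = |v| = k\<close>. Hence \<open>x\<^sup>t \<notin> J\<^sup>k\<close> iff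
  \<open>w = \<lfloor>t / m\<rfloor>\<close> satisfies \<open>\<Sum>\<lfloor>w\<^sub>i / a\<rfloor> < k\<close> or \<open>|w| < (a + 1)k\<close>. The largest \<open>|w|\<close> allowed by the first
  condition is \<open>a(k - 1) + n(a - 1)\<close>, by the second \<open>(a + 1)k - 1\<close>; the two cases of the formula
  tell which of these is larger, and the remainders of \<open>t\<close> modulo \<open>m\<close> contribute \<open>n(m - 1)\<close>.
\<close>

section \<open>Ideals of the polynomial ring\<close>

text \<open>These rewrites trade the record operations of \<open>mpol_ring\<close> for type class
  arithmetic, so that later calculations run with \<open>algebra_simps\<close> and the
  \<open>Poly_Mapping\<close> rules.\<close>

lemma mpol_ring_simps [simp]:
  "carrier mpol_ring = UNIV"
  "f \<otimes>\<^bsub>mpol_ring\<^esub> g = f * g"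
  "\<one>\<^bsub>mpol_ring\<^esub> = 1"
  "\<zero>\<^bsub>mpol_ring\<^esub> = 0"
  "f \<oplus>\<^bsub>mpol_ring\<^esub> g = f + g"
  by (simp_all add: ring_of_type_algebra_def)

lemma cring_mpol: "cring (mpol_ring :: ('n::finite, 'k::field) mpol ring)"
  by (rule cring_from_type_algebra)

lemma ring_mpol: "ring (mpol_ring :: ('n::finite, 'k::field) mpol ring)"
  by (rule ring_from_type_algebra)

lemma mpol_uminus: "\<ominus>\<^bsub>mpol_ring\<^esub> f = - (f :: ('n::finite, 'k::field) mpol)"
proof -
  interpret ring "mpol_ring :: ('n, 'k) mpol ring" by (rule ring_mpol)
  show ?thesis by (rule minus_equality) simp_all
qed

lemma mpol_power: "f [^]\<^bsub>mpol_ring\<^esub> (e::nat) = (f :: ('n::finite, 'k::field) mpol) ^ e"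
proof -
  interpret ring "mpol_ring :: ('n, 'k) mpol ring" by (rule ring_mpol)
  show ?thesis by (induction e) (simp_all add: mult.commute)
qed

text \<open>Closure under negation comes from multiplying by \<open>-1\<close>, and commutativity
  makes left multiplication enough for a two-sided ideal.\<close>

lemma ideal_mpol_iff:
  fixes H :: "('n::finite, 'k::field) mpol set"
  shows "ideal H mpol_ring \<longleftrightarrow>
    0 \<in> H \<and> (\<forall>f\<in>H. \<forall>g\<in>H. f + g \<in> H) \<and> (\<forall>f\<in>H. \<forall>g. g * f \<in> H)"
proof
  assume "ideal H mpol_ring"
  then interpret ideal H "mpol_ring :: ('n, 'k) mpol ring" .
  show "0 \<in> H \<and> (\<forall>f\<in>H. \<forall>g\<in>H. f + g \<in> H) \<and> (\<forall>f\<in>H. \<forall>g. g * f \<in> H)"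
    using additive_subgroup.zero_closed[OF additive_subgroup_axioms]
      additive_subgroup.a_closed[OF additive_subgroup_axioms] I_l_closed
    by (intro conjI ballI allI) simp_all
next
  assume H: "0 \<in> H \<and> (\<forall>f\<in>H. \<forall>g\<in>H. f + g \<in> H) \<and> (\<forall>f\<in>H. \<forall>g. g * f \<in> H)"
  interpret ring "mpol_ring :: ('n, 'k) mpol ring" by (rule ring_mpol)
  have neg: "- f \<in> H" if "f \<in> H" for f
    using H that by (metis mult_minus1)
  have "\<ominus>\<^bsub>mpol_ring\<^esub> f \<in> H" if "f \<in> H" for f
    using neg that by (simp add: mpol_uminus)
  then have "subgroup H (add_monoid mpol_ring)"
    using H by (intro add.subgroupI) (auto simp: a_inv_def)
  then show "ideal H mpol_ring"
    by (rule idealI[OF ring_mpol]) (use H in \<open>auto simp: mult.commute\<close>)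
qed

lemma ideal_mpol_add:
  assumes "ideal (H :: ('n::finite, 'k::field) mpol set) mpol_ring" "f \<in> H" "g \<in> H"
  shows "f + g \<in> H"
  using assms by (simp add: ideal_mpol_iff)

lemma ideal_mpol_diff:
  assumes "ideal (H :: ('n::finite, 'k::field) mpol set) mpol_ring" "f \<in> H" "g \<in> H"
  shows "f - g \<in> H"
  using assms unfolding ideal_mpol_iff by (metis mult_minus1 uminus_add_conv_diff add.commute)

lemma ideal_mpol_sum:
  assumes "ideal (H :: ('n::finite, 'k::field) mpol set) mpol_ring" "\<And>t. t \<in> T \<Longrightarrow> f t \<in> H"
  shows "sum f T \<in> H"
  using assms(2)
  by (induction T rule: infinite_finite_induct) (use assms(1) in \<open>auto simp: ideal_mpol_iff\<close>)

lemma mpol_coset_eq_iff: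
  fixes H :: "('n::finite, 'k::field) mpol set"
  assumes "ideal H mpol_ring"
  shows "H +>\<^bsub>mpol_ring\<^esub> f = H +>\<^bsub>mpol_ring\<^esub> g \<longleftrightarrow> f - g \<in> H"
proof
  have coset: "H +>\<^bsub>mpol_ring\<^esub> p = (\<lambda>h. h + p) ` H" for p
    by (auto simp: a_r_coset_def')
  {
    assume "H +>\<^bsub>mpol_ring\<^esub> f = H +>\<^bsub>mpol_ring\<^esub> g"
    moreover have "f \<in> (\<lambda>h. h + f) ` H"
      using assms by (auto simp: ideal_mpol_iff image_iff intro!: bexI[of _ 0])
    ultimately have "f \<in> (\<lambda>h. h + g) ` H" by (simp add: coset)
    then show "f - g \<in> H" by auto
  next
    assume fg: "f - g \<in> H"
    have "h + f \<in> (\<lambda>h. h + g) ` H" if "h \<in> H" for h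
      using ideal_mpol_add[OF assms that fg] by (auto simp: image_iff algebra_simps intro!: bexI[of _ "h + (f - g)"])
    moreover have "h + g \<in> (\<lambda>h. h + f) ` H" if "h \<in> H" for h
      using ideal_mpol_diff[OF assms that fg]
      by (auto simp: image_iff algebra_simps intro!: bexI[of _ "h - (f - g)"])
    ultimately show "H +>\<^bsub>mpol_ring\<^esub> f = H +>\<^bsub>mpol_ring\<^esub> g"
      unfolding coset by blast
  }
qed

lemma mpol_coset_zero:
  fixes H :: "('n::finite, 'k::field) mpol set"
  shows "H +>\<^bsub>mpol_ring\<^esub> 0 = H"
  by (auto simp: a_r_coset_def')

lemma mpol_expansion:
  "(f :: ('n::finite, 'k::field) mpol)
    = (\<Sum>t\<in>Poly_Mapping.keys f. Poly_Mapping.single t (Poly_Mapping.lookup f t))"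
proof (rule poly_mapping_eqI)
  fix s
  show "Poly_Mapping.lookup f s = Poly_Mapping.lookup
    (\<Sum>t\<in>Poly_Mapping.keys f. Poly_Mapping.single t (Poly_Mapping.lookup f t)) s"
    by (simp add: lookup_sum lookup_single when_def in_keys_iff)
qed

section \<open>Monomial ideals\<close>

definition multiples :: "('n::finite \<Rightarrow>\<^sub>0 nat) set \<Rightarrow> ('n \<Rightarrow>\<^sub>0 nat) set" where
  "multiples G = {g + u | g u. g \<in> G}"

text \<open>Defined through supports instead of generation, so that membership is a condition on
  exponents alone; \<open>genideal_monomials\<close> identifies it with the generated ideal.\<close>

definition monomial_ideal :: "('n::finite \<Rightarrow>\<^sub>0 nat) set \<Rightarrow> ('n, 'k::field) mpol set" where
  "monomial_ideal G = {f. Poly_Mapping.keys f \<subseteq> multiples G}"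

lemma multiples_add: "t \<in> multiples G \<Longrightarrow> s + t \<in> multiples G"
  unfolding multiples_def by (auto, metis add.assoc add.commute)

lemma mem_multiples: "g \<in> G \<Longrightarrow> g \<in> multiples G"
  unfolding multiples_def by simp (metis add.right_neutral)

lemma ideal_monomial_ideal: "ideal (monomial_ideal G :: ('n::finite, 'k::field) mpol set) mpol_ring"
  unfolding ideal_mpol_iff monomial_ideal_def
proof (intro conjI ballI allI)
  fix f g :: "('n, 'k) mpol"
  assume f: "f \<in> {f. Poly_Mapping.keys f \<subseteq> multiples G}"
  show "g * f \<in> {f. Poly_Mapping.keys f \<subseteq> multiples G}"
    using f keys_mult[of g f] multiples_add by fastforce
  assume g: "g \<in> {f. Poly_Mapping.keys f \<subseteq> multiples G}"
  show "f + g \<in> {f. Poly_Mapping.keys f \<subseteq> multiples G}"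
    using f g keys_add[of f g] by auto
qed simp

lemma single_mem_monomial_ideal:
  "Poly_Mapping.single t c \<in> monomial_ideal G \<longleftrightarrow> c = 0 \<or> t \<in> multiples G"
  by (auto simp: monomial_ideal_def)

text \<open>A polynomial is the sum of its terms, and each term here is a multiple of a monomial
  with exponent in \<open>G\<close>. This is the minimality half of ideal generation.\<close>

lemma monomial_ideal_subset:
  fixes H :: "('n::finite, 'k::field) mpol set"
  assumes H: "ideal H mpol_ring" and G: "\<And>g. g \<in> G \<Longrightarrow> Poly_Mapping.single g 1 \<in> H"
  shows "monomial_ideal G \<subseteq> H"
proof
  fix f :: "('n, 'k) mpol"
  assume f: "f \<in> monomial_ideal G"
  have "Poly_Mapping.single t (Poly_Mapping.lookup f t) \<in> H" if t: "t \<in> Poly_Mapping.keys f" for t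
  proof -
    obtain g u where g: "g \<in> G" "t = g + u"
      using f t by (auto simp: monomial_ideal_def multiples_def)
    have "Poly_Mapping.single u (Poly_Mapping.lookup f t) * Poly_Mapping.single g 1 \<in> H"
      using H G[OF g(1)] by (simp add: ideal_mpol_iff)
    then show ?thesis by (simp add: mult_single g add.commute)
  qed
  then show "f \<in> H"
    by (subst mpol_expansion) (rule ideal_mpol_sum[OF H])
qed

lemma genideal_monomials:
  fixes M :: "('n::finite, 'k::field) mpol set"
  assumes "M = (\<lambda>g. Poly_Mapping.single g 1) ` G"
  shows "Idl\<^bsub>mpol_ring\<^esub> M = monomial_ideal G"
proof
  interpret ring "mpol_ring :: ('n, 'k) mpol ring" by (rule ring_mpol)
  show "Idl\<^bsub>mpol_ring\<^esub> M \<subseteq> monomial_ideal G"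
    by (rule genideal_minimal[OF ideal_monomial_ideal])
      (auto simp: assms single_mem_monomial_ideal mem_multiples)
  show "monomial_ideal G \<subseteq> Idl\<^bsub>mpol_ring\<^esub> M"
    by (rule monomial_ideal_subset[OF genideal_ideal]) (use genideal_self[of M] assms in auto)
qed

text \<open>Exponents add under multiplication: every key of a product is a sum of keys of the
  factors, and generators multiply to generators.\<close>

lemma ideal_prod_monomial_ideal:
  "ideal_prod mpol_ring (monomial_ideal F) (monomial_ideal G :: ('n::finite, 'k::field) mpol set)
    = monomial_ideal {f + g | f g. f \<in> F \<and> g \<in> G}"
    (is "?P = monomial_ideal ?FG")
proof
  interpret ring "mpol_ring :: ('n, 'k) mpol ring" by (rule ring_mpol)
  have P: "ideal ?P mpol_ring"
    by (intro ideal_prod_is_ideal ideal_monomial_ideal)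
  show "monomial_ideal ?FG \<subseteq> ?P"
  proof (rule monomial_ideal_subset[OF P], clarify)
    fix f g assume "f \<in> F" "g \<in> G"
    then have "Poly_Mapping.single f 1 \<otimes>\<^bsub>mpol_ring\<^esub> Poly_Mapping.single g 1 \<in> ?P"
      by (intro ideal_prod.prod) (auto simp: single_mem_monomial_ideal mem_multiples)
    then show "Poly_Mapping.single (f + g) 1 \<in> ?P" by (simp add: mult_single)
  qed
  show "?P \<subseteq> monomial_ideal ?FG"
  proof
    fix p assume "p \<in> ?P"
    then show "p \<in> monomial_ideal ?FG"
    proof induction
      case (prod p q)
      have "s + t \<in> multiples ?FG"
        if "s \<in> Poly_Mapping.keys p" "t \<in> Poly_Mapping.keys q" for s t
      proof -
        have "s \<in> multiples F" "t \<in> multiples G"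
          using prod that by (auto simp: monomial_ideal_def)
        then obtain f u g v where "f \<in> F" "s = f + u" "g \<in> G" "t = g + v"
          unfolding multiples_def by blast
        then have "s + t = (f + g) + (u + v)" "f + g \<in> ?FG"
          by (auto simp: algebra_simps)
        then show ?thesis unfolding multiples_def by blast
      qed
      then show ?case
        using keys_mult[of p q] by (force simp: monomial_ideal_def)
    next
      case (sum p q)
      then show ?case
        by (simp add: ideal_mpol_add[OF ideal_monomial_ideal])
    qed
  qed
qed

lemma Var_power: "Var i ^ e = Poly_Mapping.single (Poly_Mapping.single i e) 1"
proof (induction e)
  case (Suc e)
  then show ?case by (simp add: Var_def mult_single flip: single_add)
qed simp

lemma var_power_ideal_eq:
  "var_power_ideal e = monomial_ideal (range (\<lambda>i. Poly_Mapping.single i e))"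
  unfolding var_power_ideal_def
  by (rule genideal_monomials) (auto simp: mpol_power Var_power image_image)

text \<open>The generating monomials are themselves homogeneous elements of the ideal.\<close>

lemma graded_monomial_ideal: "graded_ideal (monomial_ideal G :: ('n::finite, 'k::field) mpol set)"
  unfolding graded_ideal_def
proof (intro conjI equalityI)
  interpret ring "mpol_ring :: ('n, 'k) mpol ring" by (rule ring_mpol)
  let ?H = "monomial_ideal G :: ('n, 'k) mpol set"
  show H: "ideal ?H mpol_ring" by (rule ideal_monomial_ideal)
  show "Idl\<^bsub>mpol_ring\<^esub> (\<Union>d. ?H \<inter> graded_part d) \<subseteq> ?H"
    by (rule genideal_minimal[OF H]) auto
  show "?H \<subseteq> Idl\<^bsub>mpol_ring\<^esub> (\<Union>d. ?H \<inter> graded_part d)"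
  proof (rule monomial_ideal_subset[OF genideal_ideal])
    fix g assume "g \<in> G"
    then have "Poly_Mapping.single g 1 \<in> ?H \<inter> graded_part (mon_degree g)"
      by (simp add: single_mem_monomial_ideal mem_multiples graded_part_def)
    then show "Poly_Mapping.single g 1 \<in> Idl\<^bsub>mpol_ring\<^esub> (\<Union>d. ?H \<inter> graded_part d)"
      using genideal_self[of "\<Union>d. ?H \<inter> graded_part d"] by auto
  qed simp
qed

text \<open>The degree \<open>d\<close> part of the quotient vanishes iff all forms of degree
  \<open>d\<close> lie in \<open>H\<close>, and for a monomial ideal it suffices to test
  monomials.\<close>

lemma quot_graded_part_monomial_ideal:
  "quot_graded_part H d \<noteq> {\<zero>\<^bsub>mpol_ring Quot H\<^esub>} \<longleftrightarrow> (\<exists>t. mon_degree t = d \<and> t \<notin> multiples G)"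
  if H_eq: "H = (monomial_ideal G :: ('n::finite, 'k::field) mpol set)"
proof -
  have H: "ideal H mpol_ring" using H_eq ideal_monomial_ideal by simp
  have zero: "\<zero>\<^bsub>mpol_ring Quot H\<^esub> = H +>\<^bsub>mpol_ring\<^esub> 0"
    by (simp add: FactRing_def mpol_coset_zero)
  \<comment> \<open>The image of \<open>graded_part d\<close> is therefore nonempty, so being a
    singleton reduces to a universal statement.\<close>
  have "0 \<in> (graded_part d :: ('n, 'k) mpol set)"
    by (simp add: graded_part_def)
  then have "quot_graded_part H d = {\<zero>\<^bsub>mpol_ring Quot H\<^esub>}
      \<longleftrightarrow> (\<forall>f\<in>graded_part d. H +>\<^bsub>mpol_ring\<^esub> f = H +>\<^bsub>mpol_ring\<^esub> 0)"
    unfolding quot_graded_part_def zero by blast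
  also have "\<dots> \<longleftrightarrow> (\<forall>f\<in>graded_part d. f \<in> H)"
    by (simp add: mpol_coset_eq_iff[OF H])
  also have "\<dots> \<longleftrightarrow> (\<forall>t. mon_degree t = d \<longrightarrow> t \<in> multiples G)"
  proof (intro iffI allI impI ballI)
    fix t :: "'n \<Rightarrow>\<^sub>0 nat"
    assume "\<forall>f\<in>graded_part d. f \<in> H" "mon_degree t = d"
    moreover from this(2) have "Poly_Mapping.single t 1 \<in> (graded_part d :: ('n, 'k) mpol set)"
      by (simp add: graded_part_def)
    ultimately have "Poly_Mapping.single t 1 \<in> H" by blast
    then show "t \<in> multiples G"
      by (simp add: H_eq single_mem_monomial_ideal)
  qed (auto simp: graded_part_def H_eq monomial_ideal_def)
  finally show ?thesis by blast
qed

text \<open>The witness \<open>t\<close> together with the uniform bound \<open>d\<close> shows that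
  the maximum behind \<open>GREATEST\<close> exists, so its value is determined.\<close>

lemma socle_degree_monomial_ideal:
  assumes "t \<notin> multiples G" "mon_degree t = d"
    and "\<And>s. s \<notin> multiples G \<Longrightarrow> mon_degree s \<le> d"
  shows "socle_degree (monomial_ideal G :: ('n::finite, 'k::field) mpol set) = d"
  unfolding socle_degree_def quot_graded_part_monomial_ideal[OF refl]
  by (rule Greatest_equality) (use assms in auto)

section \<open>Dimension zero\<close>

text \<open>Taking the constant term is evaluation at the origin, hence multiplicative. This is what
  makes \<open>max_ideal\<close> prime.\<close>

lemma lookup_mult_zero:
  "Poly_Mapping.lookup (f * g) 0 = Poly_Mapping.lookup f 0 * Poly_Mapping.lookup g 0"
  for f g :: "('n::finite, 'k::field) mpol"
proof -
  let ?c = "\<lambda>f :: ('n, 'k) mpol. Poly_Mapping.single 0 (Poly_Mapping.lookup f 0)"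
  have nonzero: "Poly_Mapping.lookup (p * q) 0 = 0" if "Poly_Mapping.lookup q 0 = 0"
    for p q :: "('n, 'k) mpol"
  proof (rule ccontr)
    assume "Poly_Mapping.lookup (p * q) 0 \<noteq> 0"
    then have "0 \<in> Poly_Mapping.keys (p * q)" by (simp add: in_keys_iff)
    then obtain s t where "0 = s + t" and t: "t \<in> Poly_Mapping.keys q"
      using keys_mult[of p q] by blast
    then have "Poly_Mapping.lookup t i = 0" for i
      by (metis add_is_0 lookup_add lookup_zero)
    then have "t = 0" by (intro poly_mapping_eqI) simp
    then show False using that t by (simp add: in_keys_iff)
  qed
  \<comment> \<open>Splitting off constant terms leaves two products having a factor without
    constant term; by \<open>nonzero\<close> these contribute nothing at exponent
    \<open>0\<close>.\<close>
  have "f * g = f * (g - ?c g) + ?c g * (f - ?c f) + ?c f * ?c g"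
    by (simp add: algebra_simps)
  moreover have "Poly_Mapping.lookup (f * (g - ?c g)) 0 = 0"
    by (rule nonzero) (simp add: lookup_minus)
  moreover have "Poly_Mapping.lookup (?c g * (f - ?c f)) 0 = 0"
    by (rule nonzero) (simp add: lookup_minus)
  ultimately show ?thesis by (simp add: lookup_add mult_single)
qed

abbreviation max_ideal :: "('n::finite, 'k::field) mpol set" where
  "max_ideal \<equiv> {f. Poly_Mapping.lookup f 0 = 0}"

text \<open>A nonzero exponent vector has a positive coordinate, so its monomial is divisible by a
  variable. In this form, an ideal containing all variables is seen to contain
  \<open>max_ideal\<close>.\<close>

lemma max_ideal_eq: "max_ideal = monomial_ideal (range (\<lambda>i. Poly_Mapping.single i 1))"
proof -
  have "t \<noteq> 0 \<longleftrightarrow> t \<in> multiples (range (\<lambda>i. Poly_Mapping.single i 1))" for t :: "'a \<Rightarrow>\<^sub>0 nat"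
  proof
    assume "t \<noteq> 0"
    then obtain i where "Poly_Mapping.lookup t i \<noteq> 0"
      by (metis poly_mapping_eqI lookup_zero)
    then have "t = Poly_Mapping.single i 1 + (t - Poly_Mapping.single i 1)"
      by (intro poly_mapping_eqI) (auto simp: lookup_add lookup_minus lookup_single when_def)
    then show "t \<in> multiples (range (\<lambda>i. Poly_Mapping.single i 1))"
      unfolding multiples_def by blast
  next
    assume "t \<in> multiples (range (\<lambda>i. Poly_Mapping.single i 1))"
    then obtain i u where "t = Poly_Mapping.single i 1 + u"
      by (auto simp: multiples_def)
    then have "Poly_Mapping.lookup t i \<noteq> 0" by (simp add: lookup_add)
    then show "t \<noteq> 0" by auto
  qed
  then have "- {0} = multiples (range (\<lambda>i. Poly_Mapping.single i 1) :: ('a \<Rightarrow>\<^sub>0 nat) set)" by blast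
  then show ?thesis
    by (auto simp: monomial_ideal_def in_keys_iff subset_eq simp flip: \<open>- {0} = _\<close>)
qed

text \<open>Every variable is nilpotent modulo \<open>H\<close>, so \<open>max_ideal\<close> is the only prime containing \<open>H\<close>.\<close>

lemma krull_dim_quot_eq_0:
  fixes H :: "('n::finite, 'k::field) mpol set"
  assumes H: "ideal H mpol_ring" and sub: "H \<subseteq> max_ideal"
    and pow: "\<And>i. \<exists>e. Var i ^ e \<in> H"
  shows "krull_dim (mpol_ring Quot H) = 0"
proof -
  let ?R = "mpol_ring :: ('n, 'k) mpol ring"
  let ?\<pi> = "\<lambda>f. H +>\<^bsub>?R\<^esub> f"
  interpret R: cring ?R by (rule cring_mpol)
  interpret H: ideal H ?R by (rule H)
  interpret \<pi>: ring_hom_ring ?R "?R Quot H" ?\<pi> by (rule H.rcos_ring_hom_ring)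
  have Q: "cring (?R Quot H)" by (rule H.quotient_is_cring) (rule cring_mpol)
  have carr: "carrier (?R Quot H) = range ?\<pi>"
    by (auto simp: FactRing_def A_RCOSETS_def')
  have max: "ideal max_ideal ?R"
    unfolding max_ideal_eq by (rule ideal_monomial_ideal)
  \<comment> \<open>Since \<open>H\<close> lies in \<open>max_ideal\<close>, membership does not
    depend on the representative of a coset.\<close>
  have mem: "?\<pi> f \<in> ?\<pi> ` max_ideal \<longleftrightarrow> f \<in> max_ideal" for f
  proof
    assume "?\<pi> f \<in> ?\<pi> ` max_ideal"
    then obtain g where "g \<in> max_ideal" "f - g \<in> max_ideal"
      using sub by (auto simp: mpol_coset_eq_iff[OF H])
    then show "f \<in> max_ideal" by (simp add: lookup_minus)
  qed auto
  have unique: "P = ?\<pi> ` max_ideal" if P: "primeideal P (?R Quot H)" for P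
  proof -
    let ?Q = "{f \<in> carrier ?R. ?\<pi> f \<in> P}"
    interpret P: primeideal P "?R Quot H" by (rule P)
    interpret Q: primeideal ?Q ?R
      by (rule \<pi>.primeideal_vimage[OF cring_mpol P])
    have HQ: "H \<subseteq> ?Q"
    proof
      fix h assume "h \<in> H"
      then have "?\<pi> h = ?\<pi> 0" by (simp add: mpol_coset_eq_iff[OF H])
      also have "\<dots> = \<zero>\<^bsub>?R Quot H\<^esub>" by (simp add: FactRing_def mpol_coset_zero)
      finally show "h \<in> ?Q" using P.zero_closed by simp
    qed
    \<comment> \<open>Properness of the prime is used twice: it settles exponent \<open>0\<close> in
      the descent from \<open>Var i ^ e\<close> to \<open>Var i\<close>, and it excludes nonzero
      constants.\<close>
    have not1: "1 \<notin> ?Q"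
      using Q.I_notcarr Q.one_imp_carrier by auto
    have "Var i \<in> ?Q" for i
    proof -
      obtain e where "Var i ^ e \<in> H" using pow by blast
      then have "Var i ^ e \<in> ?Q" using HQ by blast
      then show ?thesis
      proof (induction e)
        case 0
        with not1 show ?case by simp
      next
        case (Suc e)
        then have "Var i \<otimes>\<^bsub>?R\<^esub> Var i ^ e \<in> ?Q" by simp
        from Q.I_prime[OF _ _ this] Suc.IH show ?case by auto
      qed
    qed
    then have le: "max_ideal \<subseteq> ?Q"
      unfolding max_ideal_eq
      by (intro monomial_ideal_subset[OF Q.is_ideal]) (auto simp: Var_def)
    \<comment> \<open>An element with nonzero constant term, minus its part in
      \<open>max_ideal\<close>, would leave a unit in \<open>?Q\<close>.\<close>
    have "?Q \<subseteq> max_ideal"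
    proof
      fix f assume f: "f \<in> ?Q"
      show "f \<in> max_ideal"
      proof (rule ccontr)
        let ?c = "Poly_Mapping.lookup f 0"
        assume "f \<notin> max_ideal"
        then have c: "?c \<noteq> 0" by simp
        have "f - Poly_Mapping.single 0 ?c \<in> max_ideal"
          by (simp add: lookup_minus)
        then have "f - Poly_Mapping.single 0 ?c \<in> ?Q"
          using le by blast
        from ideal_mpol_diff[OF Q.is_ideal f this]
        have "Poly_Mapping.single 0 ?c \<in> ?Q" by simp
        then have "Poly_Mapping.single 0 (inverse ?c) * Poly_Mapping.single 0 ?c \<in> ?Q"
          using Q.is_ideal unfolding ideal_mpol_iff by blast
        with not1 c show False by (simp add: mult_single)
      qed
    qed
    with le have "?Q = max_ideal" by blast
    moreover have "P = ?\<pi> ` ?Q"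
      using P.a_subset carr by auto
    ultimately show ?thesis by simp
  qed
  have "primeideal (?\<pi> ` max_ideal) (?R Quot H)"
  proof (rule primeidealI[OF _ Q])
    show "ideal (?\<pi> ` max_ideal) (?R Quot H)"
      by (rule R.ring_ideal_imp_quot_ideal[OF H max])
    have "?\<pi> 1 \<notin> ?\<pi> ` max_ideal" unfolding mem by simp
    then show "carrier (?R Quot H) \<noteq> ?\<pi> ` max_ideal" using carr by blast
  next
    fix x y
    assume "x \<in> carrier (?R Quot H)" "y \<in> carrier (?R Quot H)"
      and xy: "x \<otimes>\<^bsub>?R Quot H\<^esub> y \<in> ?\<pi> ` max_ideal"
    then obtain f g where fg: "x = ?\<pi> f" "y = ?\<pi> g" using carr by auto
    have "?\<pi> (f * g) \<in> ?\<pi> ` max_ideal"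
      using xy \<pi>.hom_mult[of f g] by (simp add: fg)
    then have "f \<in> max_ideal \<or> g \<in> max_ideal"
      unfolding mem by (simp add: lookup_mult_zero)
    then show "x \<in> ?\<pi> ` max_ideal \<or> y \<in> ?\<pi> ` max_ideal"
      unfolding fg mem .
  qed
  then have "{ereal (real l) | l. \<exists>P :: nat \<Rightarrow> ('n, 'k) mpol set set.
     (\<forall>i\<le>l. primeideal (P i) (?R Quot H)) \<and> (\<forall>i<l. P i \<subset> P (Suc i))} = {0}"
    (is "?L = _")
  proof (intro equalityI subsetI)
    fix x assume "x \<in> ?L"
    then obtain l P where x: "x = ereal (real l)"
      and P: "\<And>i. i \<le> l \<Longrightarrow> primeideal (P i) (?R Quot H)" "\<And>i. i < l \<Longrightarrow> P i \<subset> P (Suc i)"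
      by blast
    have "l = 0"
    proof (rule ccontr)
      assume "l \<noteq> 0"
      then have "P 0 \<subset> P (Suc 0)" "P 0 = ?\<pi> ` max_ideal" "P (Suc 0) = ?\<pi> ` max_ideal"
        using P unique by simp_all
      then show False by simp
    qed
    then show "x \<in> {0}" by (simp add: x)
  next
    fix x :: ereal assume "x \<in> {0}"
    with \<open>primeideal (?\<pi> ` max_ideal) (?R Quot H)\<close> show "x \<in> ?L"
      by (auto intro!: exI[of _ 0] exI[of _ "\<lambda>_. ?\<pi> ` max_ideal"])
  qed
  then show ?thesis unfolding krull_dim_def by simp
qed

section \<open>The powers of \<open>J\<close>\<close>

text \<open>In a product of \<open>k\<close> generators of J, \<open>u i\<close> counts the chosen
  factors \<open>Var i ^ (a * m)\<close> and \<open>v i\<close> the chosen factors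
  \<open>Var i ^ m\<close>.\<close>

definition power_exponents :: "nat \<Rightarrow> nat \<Rightarrow> nat \<Rightarrow> ('n::finite \<Rightarrow>\<^sub>0 nat) set" where
  "power_exponents m a k = {t. \<exists>u v. sum u UNIV = k \<and> sum v UNIV = k \<and>
     (\<forall>i. Poly_Mapping.lookup t i = m * (a * u i + v i))}"

lemma sum_Suc_obtain:
  fixes u :: "'n::finite \<Rightarrow> nat"
  assumes "sum u UNIV = Suc k"
  obtains i u' where "sum u' UNIV = k" "\<And>x. u x = u' x + (if x = i then 1 else 0)"
proof -
  obtain i where i: "u i > 0"
    using assms by (metis Zero_not_Suc bot_nat_0.not_eq_extremum sum.neutral)
  define u' where "u' = (\<lambda>x. u x - (if x = i then 1 else 0))"
  have u: "u x = u' x + (if x = i then 1 else 0)" for x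
    using i by (simp add: u'_def)
  have "sum u UNIV = sum u' UNIV + 1"
    unfolding u by (simp add: sum.distrib)
  with assms u that show thesis by simp
qed

text \<open>Removing one unit from \<open>u\<close> and one from \<open>v\<close> splits off a
  single generator of J; adding the units back gives the converse.\<close>

lemma power_exponents_Suc:
  "power_exponents m a (Suc k) = {s + t | s t. s \<in> power_exponents m a k \<and>
     t \<in> {Poly_Mapping.single i (a * m) + Poly_Mapping.single j m | i j. True}}"
  (is "_ = ?R")
proof (intro equalityI subsetI)
  fix t :: "'a \<Rightarrow>\<^sub>0 nat" assume "t \<in> power_exponents m a (Suc k)"
  then obtain u v where uv: "sum u UNIV = Suc k" "sum v UNIV = Suc k"
    and t: "\<And>i. Poly_Mapping.lookup t i = m * (a * u i + v i)"
    by (auto simp: power_exponents_def)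
  obtain i u' where u': "sum u' UNIV = k" "\<And>x. u x = u' x + (if x = i then 1 else 0)"
    using sum_Suc_obtain[OF uv(1)] by blast
  obtain j v' where v': "sum v' UNIV = k" "\<And>x. v x = v' x + (if x = j then 1 else 0)"
    using sum_Suc_obtain[OF uv(2)] by blast
  define s where "s = Abs_poly_mapping (\<lambda>x. m * (a * u' x + v' x))"
  have s: "Poly_Mapping.lookup s x = m * (a * u' x + v' x)" for x
    unfolding s_def by (subst lookup_Abs_poly_mapping) auto
  then have "s \<in> power_exponents m a k"
    using u'(1) v'(1) by (auto simp: power_exponents_def)
  moreover have "t = s + (Poly_Mapping.single i (a * m) + Poly_Mapping.single j m)"
    by (intro poly_mapping_eqI)
      (auto simp: lookup_add lookup_single when_def t s u'(2) v'(2) algebra_simps)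
  ultimately show "t \<in> ?R" by blast
next
  fix t :: "'a \<Rightarrow>\<^sub>0 nat" assume "t \<in> ?R"
  then obtain s i j where t: "t = s + (Poly_Mapping.single i (a * m) + Poly_Mapping.single j m)"
    and "s \<in> power_exponents m a k" by blast
  then obtain u v where uv: "sum u UNIV = k" "sum v UNIV = k"
    and s: "\<And>i. Poly_Mapping.lookup s i = m * (a * u i + v i)"
    by (auto simp: power_exponents_def)
  have "sum (\<lambda>x. u x + (if x = i then 1 else 0)) UNIV = Suc k"
    "sum (\<lambda>x. v x + (if x = j then 1 else 0)) UNIV = Suc k"
    using uv by (simp_all add: sum.distrib)
  moreover have "Poly_Mapping.lookup t x
      = m * (a * (u x + (if x = i then 1 else 0)) + (v x + (if x = j then 1 else 0)))" for x
    by (auto simp: t lookup_add lookup_single when_def s algebra_simps)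
  ultimately show "t \<in> power_exponents m a (Suc k)"
    unfolding power_exponents_def by blast
qed

lemma ideal_power_eq:
  "ideal_power mpol_ring (ideal_prod mpol_ring (var_power_ideal (a * m)) (var_power_ideal m)) k
    = (monomial_ideal (power_exponents m a k) :: ('n::finite, 'k::field) mpol set)"
proof (induction k)
  case 0
  have "(0 :: 'n \<Rightarrow>\<^sub>0 nat) \<in> power_exponents m a 0"
    by (auto simp: power_exponents_def)
  \<comment> \<open>The zeroth power is the unit for the product of ideals, that is, the whole
    ring.\<close>
  then have "multiples (power_exponents m a 0) = (UNIV :: ('n \<Rightarrow>\<^sub>0 nat) set)"
    using multiples_add[OF mem_multiples] by fastforce
  then show ?case
    by (simp add: nat_pow_def ideals_set_def monomial_ideal_def)
next
  case (Suc k)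
  let ?E = "{Poly_Mapping.single i (a * m) + Poly_Mapping.single j m | i j :: 'n. True}"
  have J: "ideal_prod mpol_ring (var_power_ideal (a * m)) (var_power_ideal m)
      = (monomial_ideal ?E :: ('n, 'k) mpol set)"
    unfolding var_power_ideal_eq ideal_prod_monomial_ideal
    by (rule arg_cong[of _ _ monomial_ideal]) blast
  show ?case
    using Suc unfolding J power_exponents_Suc ideal_prod_monomial_ideal[symmetric]
    by (simp add: nat_pow_def ideals_set_def)
qed

section \<open>Membership in powers of J as two inequalities\<close>

text \<open>Greedy choice: the new index takes \<open>min k (w x)\<close>, and what remains of
  \<open>k\<close> fits into the other indices.\<close>

lemma exists_le_with_sum:
  fixes w :: "'a \<Rightarrow> nat"
  assumes "finite A" "k \<le> sum w A"
  shows "\<exists>u. (\<forall>i. u i \<le> w i) \<and> sum u A = k"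
  using assms
proof (induction A arbitrary: k rule: finite_induct)
  case empty
  then show ?case by (auto intro!: exI[of _ "\<lambda>_. 0"])
next
  case (insert x A)
  then have "k - min k (w x) \<le> sum w A" by auto
  from insert.IH[OF this] obtain u where "\<forall>i. u i \<le> w i" "sum u A = k - min k (w x)" by blast
  moreover from this have "sum (u(x := min k (w x))) A = k - min k (w x)"
    using insert.hyps by (metis (mono_tags, lifting) fun_upd_other sum.cong)
  ultimately show ?case
    using insert.hyps by (intro exI[of _ "u(x := min k (w x))"]) auto
qed

text \<open>A monomial \<open>t\<close> lies in \<open>J\<^sup>k\<close> iff, with \<open>w = \<lfloor>t / m\<rfloor>\<close>, one can first spend \<open>k\<close> blocks of
  size \<open>a\<close> inside the \<open>w\<^sub>i\<close> and then \<open>k\<close> more units from whatever is left.\<close>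

lemma multiples_power_exponents_iff:
  fixes t :: "'n::finite \<Rightarrow>\<^sub>0 nat"
  assumes "m \<ge> 1" "a \<ge> 1"
  shows "t \<in> multiples (power_exponents m a k) \<longleftrightarrow>
    k \<le> (\<Sum>i\<in>UNIV. Poly_Mapping.lookup t i div m div a) \<and>
    (a + 1) * k \<le> (\<Sum>i\<in>UNIV. Poly_Mapping.lookup t i div m)"
    (is "_ \<longleftrightarrow> k \<le> sum ?q UNIV \<and> _ \<le> sum ?w UNIV")
proof
  assume "t \<in> multiples (power_exponents m a k)"
  then obtain g r u v where t: "t = g + r" and u: "sum u UNIV = k" and v: "sum v UNIV = k"
    and g: "\<And>i. Poly_Mapping.lookup g i = m * (a * u i + v i)"
    by (auto simp: multiples_def power_exponents_def)
  have w: "a * u i + v i \<le> ?w i" for i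
    using assms by (simp add: t lookup_add g less_eq_div_iff_mult_less_eq)
  have q: "u i \<le> ?q i" for i
  proof -
    have "a * u i \<le> ?w i" using w[of i] by (rule add_leD1)
    then show ?thesis
      using div_le_mono[of "a * u i" "?w i" a] assms by simp
  qed
  have "(a + 1) * k = (\<Sum>i\<in>UNIV. a * u i + v i)"
    using u v by (simp add: sum.distrib flip: sum_distrib_left)
  also have "\<dots> \<le> sum ?w UNIV" by (intro sum_mono w)
  finally show "k \<le> sum ?q UNIV \<and> (a + 1) * k \<le> sum ?w UNIV"
    using u q by (auto intro: sum_mono)
next
  assume qw: "k \<le> sum ?q UNIV \<and> (a + 1) * k \<le> sum ?w UNIV"
  \<comment> \<open>Any choice of \<open>k\<close> whole blocks works, because the second inequality
    depends only on the total.\<close>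
  then obtain u where u: "\<And>i. u i \<le> ?q i" "sum u UNIV = k"
    using exists_le_with_sum[of UNIV k ?q] by auto
  have aq: "a * u i \<le> ?w i" for i
    using u(1)[of i] assms by (simp add: less_eq_div_iff_mult_less_eq mult.commute)
  \<comment> \<open>The blocks use exactly \<open>a * k\<close> of a total of at least
    \<open>(a + 1) * k\<close>, so \<open>k\<close> units are left for \<open>v\<close>; by
    \<open>aq\<close> no subtraction is truncated.\<close>
  have "a * k + (\<Sum>i\<in>UNIV. ?w i - a * u i) = (\<Sum>i\<in>UNIV. a * u i + (?w i - a * u i))"
    using u(2) by (simp add: sum.distrib flip: sum_distrib_left)
  also have "\<dots> = sum ?w UNIV"
    using aq by simp
  finally have "k \<le> (\<Sum>i\<in>UNIV. ?w i - a * u i)"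
    using qw by simp
  then obtain v where v: "\<And>i. v i \<le> ?w i - a * u i" "sum v UNIV = k"
    using exists_le_with_sum[of UNIV k "\<lambda>i. ?w i - a * u i"] by auto
  define g where "g = Abs_poly_mapping (\<lambda>i. m * (a * u i + v i))"
  have g: "Poly_Mapping.lookup g i = m * (a * u i + v i)" for i
    unfolding g_def by (subst lookup_Abs_poly_mapping) auto
  have "Poly_Mapping.lookup g i \<le> Poly_Mapping.lookup t i" for i
  proof -
    have "a * u i + v i \<le> ?w i" using v(1)[of i] aq[of i] by simp
    then show ?thesis
      using assms by (simp add: g less_eq_div_iff_mult_less_eq mult.commute)
  qed
  then have "t = g + (t - g)"
    by (intro poly_mapping_eqI) (simp add: lookup_add lookup_minus)
  moreover have "g \<in> power_exponents m a k"
    using u(2) v(2) g by (auto simp: power_exponents_def)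
  ultimately show "t \<in> multiples (power_exponents m a k)"
    unfolding multiples_def by blast
qed

section \<open>Largest degree of a monomial outside a power of J\<close>

lemma mon_degree_le_div:
  fixes t :: "'n::finite \<Rightarrow>\<^sub>0 nat"
  assumes "m \<ge> 1"
  shows "mon_degree t \<le> m * (\<Sum>i\<in>UNIV. Poly_Mapping.lookup t i div m) + CARD('n) * (m - 1)"
proof -
  have "Poly_Mapping.lookup t i \<le> m * (Poly_Mapping.lookup t i div m) + (m - 1)" for i
  proof -
    have "Poly_Mapping.lookup t i mod m < m" using assms by simp
    then show ?thesis
      using mult_div_mod_eq[of m "Poly_Mapping.lookup t i"] by linarith
  qed
  then have "mon_degree t \<le> (\<Sum>i\<in>UNIV. m * (Poly_Mapping.lookup t i div m) + (m - 1))"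
    unfolding mon_degree_def by (rule sum_mono)
  then show ?thesis by (simp add: sum.distrib flip: sum_distrib_left)
qed

text \<open>Giving every coordinate the largest remainder \<open>m - 1\<close> attains the bound of
  \<open>mon_degree_le_div\<close>.\<close>

lemma exists_mon_with_div:
  fixes w :: "'n::finite \<Rightarrow> nat"
  assumes "m \<ge> 1"
  obtains t :: "'n \<Rightarrow>\<^sub>0 nat" where "\<And>i. Poly_Mapping.lookup t i div m = w i"
    and "mon_degree t = m * sum w UNIV + CARD('n) * (m - 1)"
proof
  define t where "t = Abs_poly_mapping (\<lambda>i. m * w i + (m - 1))"
  have t: "Poly_Mapping.lookup t i = m * w i + (m - 1)" for i
    unfolding t_def by (subst lookup_Abs_poly_mapping) auto
  show "Poly_Mapping.lookup t i div m = w i" for i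
    using assms unfolding t by (subst div_mult_self4) auto
  show "mon_degree t = m * sum w UNIV + CARD('n) * (m - 1)"
    by (simp add: mon_degree_def t sum.distrib flip: sum_distrib_left)
qed

lemma sum_le_sum_div:
  fixes w :: "'n::finite \<Rightarrow> nat"
  assumes "a \<ge> 1"
  shows "sum w UNIV \<le> a * (\<Sum>i\<in>UNIV. w i div a) + CARD('n) * (a - 1)"
proof -
  have "w i \<le> a * (w i div a) + (a - 1)" for i
  proof -
    have "w i mod a < a" using assms by simp
    then show ?thesis using mult_div_mod_eq[of a "w i"] by linarith
  qed
  then have "sum w UNIV \<le> (\<Sum>i\<in>UNIV. a * (w i div a) + (a - 1))"
    by (rule sum_mono)
  then show ?thesis by (simp add: sum.distrib flip: sum_distrib_left)
qed

text \<open>A monomial is outside the ideal iff one of the two membership inequalities fails.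
  \<open>?A\<close> and \<open>?B\<close> are the largest totals of \<open>w\<close> when the
  second, respectively the first, fails.\<close>

lemma socle_degree_power_exponents:
  assumes "m \<ge> 1" "a \<ge> 1" "k \<ge> 1"
  shows "socle_degree (monomial_ideal (power_exponents m a k) :: ('n::finite, 'k::field) mpol set)
    = m * max ((a + 1) * k - 1) (a * (k - 1) + CARD('n) * (a - 1)) + CARD('n) * (m - 1)"
    (is "_ = m * max ?A ?B + _")
proof -
  fix j :: 'n
  have "\<exists>w :: 'n \<Rightarrow> nat. ((\<Sum>i\<in>UNIV. w i div a) < k \<or> sum w UNIV < (a + 1) * k) \<and> sum w UNIV = max ?A ?B"
  proof (cases "?A \<ge> ?B")
    case True
    \<comment> \<open>One below the threshold \<open>(a + 1) * k\<close>; the distribution over the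
      coordinates is irrelevant, so all of it sits at \<open>j\<close>.\<close>
    let ?w = "\<lambda>i. if i = j then ?A else 0"
    have "sum ?w UNIV = ?A" by simp
    moreover have "?A < (a + 1) * k" using assms by simp
    ultimately show ?thesis using True by (intro exI[of _ ?w]) (simp add: max_def)
  next
    case False
    \<comment> \<open>Only \<open>k - 1\<close> blocks are available, all placed at
      \<open>j\<close>, and each coordinate carries the maximal remainder
      \<open>a - 1\<close>.\<close>
    let ?w = "\<lambda>i. a * (if i = j then k - 1 else 0) + (a - 1)"
    have "?w i div a = (if i = j then k - 1 else 0)" for i
      using assms by (subst div_mult_self4) auto
    then have "(\<Sum>i\<in>UNIV. ?w i div a) < k"
      using assms by simp
    moreover have "sum ?w UNIV = ?B"
      by (simp add: sum.distrib flip: sum_distrib_left)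
    ultimately show ?thesis using False by (intro exI[of _ ?w]) simp
  qed
  then obtain w :: "'n \<Rightarrow> nat" where w: "(\<Sum>i\<in>UNIV. w i div a) < k \<or> sum w UNIV < (a + 1) * k"
    and sum_w: "sum w UNIV = max ?A ?B" by blast
  obtain t :: "'n \<Rightarrow>\<^sub>0 nat" where t: "\<And>i. Poly_Mapping.lookup t i div m = w i"
    and deg: "mon_degree t = m * sum w UNIV + CARD('n) * (m - 1)"
    using exists_mon_with_div[OF assms(1), of w] by blast
  show ?thesis
  proof (rule socle_degree_monomial_ideal)
    show "t \<notin> multiples (power_exponents m a k)"
      using w by (auto simp: multiples_power_exponents_iff[OF assms(1,2)] t)
    show "mon_degree t = m * max ?A ?B + CARD('n) * (m - 1)"
      by (simp only: deg sum_w)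
  next
    fix s :: "'n \<Rightarrow>\<^sub>0 nat"
    let ?w = "\<lambda>i. Poly_Mapping.lookup s i div m"
    assume "s \<notin> multiples (power_exponents m a k)"
    then consider "(\<Sum>i\<in>UNIV. ?w i div a) < k" | "sum ?w UNIV < (a + 1) * k"
      by (auto simp: multiples_power_exponents_iff[OF assms(1,2)] not_le)
    then have "sum ?w UNIV \<le> max ?A ?B"
    proof cases
      case 1
      then have "a * (\<Sum>i\<in>UNIV. ?w i div a) \<le> a * (k - 1)" by (intro mult_left_mono) auto
      then show ?thesis using sum_le_sum_div[OF assms(2), of ?w] by linarith
    qed linarith
    then have "m * sum ?w UNIV \<le> m * max ?A ?B" by (rule mult_left_mono) simp
    then show "mon_degree s \<le> m * max ?A ?B + CARD('n) * (m - 1)"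
      using mon_degree_le_div[OF assms(1), of s] by linarith
  qed
qed

text \<open>The condition \<open>sum v UNIV = k\<close> with \<open>k \<ge> 1\<close> excludes the
  exponent \<open>0\<close>, and each variable has a pure power among the generators.\<close>

lemma krull_dim_power_exponents:
  assumes "m \<ge> 1" "k \<ge> 1"
  shows "krull_dim (mpol_ring Quot
    (monomial_ideal (power_exponents m a k) :: ('n::finite, 'k::field) mpol set)) = 0"
proof (rule krull_dim_quot_eq_0[OF ideal_monomial_ideal])
  have "0 \<notin> multiples (power_exponents m a k :: ('n \<Rightarrow>\<^sub>0 nat) set)"
  proof
    assume "0 \<in> multiples (power_exponents m a k :: ('n \<Rightarrow>\<^sub>0 nat) set)"
    then obtain g r :: "'n \<Rightarrow>\<^sub>0 nat" and u v where gr: "0 = g + r" and v: "sum v UNIV = k"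
      and g: "\<And>i. Poly_Mapping.lookup g i = m * (a * u i + v i)"
      by (auto simp: multiples_def power_exponents_def)
    have "Poly_Mapping.lookup g i = 0" for i
      using gr by (metis add_is_0 lookup_add lookup_zero)
    then have "v i = 0" for i using g[of i] assms by simp
    then show False using v assms by simp
  qed
  then show "monomial_ideal (power_exponents m a k) \<subseteq> (max_ideal :: ('n, 'k) mpol set)"
    by (auto simp: monomial_ideal_def in_keys_iff)
next
  fix i :: 'n
  \<comment> \<open>Taking \<open>u\<close> and \<open>v\<close> both concentrated at
    \<open>i\<close> gives the pure power with exponent \<open>m * (a * k + k)\<close>.\<close>
  let ?u = "\<lambda>x. if x = i then k else 0"
  let ?e = "Poly_Mapping.single i (m * (a * k + k))"
  have "sum ?u UNIV = k" by simp
  moreover have "Poly_Mapping.lookup ?e x = m * (a * ?u x + ?u x)" for x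
    by (auto simp: lookup_single when_def)
  ultimately have "?e \<in> power_exponents m a k"
    unfolding power_exponents_def by blast
  then have "Var i ^ (m * (a * k + k)) \<in> (monomial_ideal (power_exponents m a k) :: ('n, 'k) mpol set)"
    by (simp add: Var_power single_mem_monomial_ideal mem_multiples)
  then show "\<exists>e. Var i ^ e \<in> (monomial_ideal (power_exponents m a k) :: ('n, 'k) mpol set)" ..
qed

text \<open>Gradedness and dimension zero are included because they make \<open>socle_degree\<close>
  meaningful. The formulas are stated over the integers to avoid truncated subtraction.\<close>

theorem corollary1p4:
  fixes J :: "('n::finite, 'k::field) mpol set"
    and m a n k :: nat
  assumes "m \<ge> 1" and "a \<ge> 3" and "n \<ge> 2" and "CARD('n) = n"
    and "J = ideal_prod mpol_ring (var_power_ideal (a * m)) (var_power_ideal m)"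
    and "k \<ge> 1"
  shows "graded_ideal (ideal_power mpol_ring J k)
    \<and> krull_dim (mpol_ring Quot ideal_power mpol_ring J k) = 0
    \<and> (k \<le> (n - 1) * (a - 1) \<longrightarrow>
        int (socle_degree (ideal_power mpol_ring J k))
          = int m * int a * (int k + int n - 1) - int n)
    \<and> (k \<ge> (n - 1) * (a - 1) \<longrightarrow>
        int (socle_degree (ideal_power mpol_ring J k))
          = int m * (int a * int k + int k + int n - 1) - int n)"
proof -
  have H: "ideal_power mpol_ring J k = monomial_ideal (power_exponents m a k)"
    using ideal_power_eq assms(5) by simp
  let ?A = "(a + 1) * k - 1" and ?B = "a * (k - 1) + n * (a - 1)"
  have a: "a \<ge> 1" using assms(2) by simp
  have s: "socle_degree (ideal_power mpol_ring J k) = m * max ?A ?B + n * (m - 1)"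
    unfolding H socle_degree_power_exponents[OF assms(1) a assms(6)] assms(4) ..
  have A: "int ?A = (int a + 1) * int k - 1"
    using assms(6) by (simp add: of_nat_diff algebra_simps)
  have B: "int ?B = int a * (int k - 1) + int n * (int a - 1)"
    using assms(6) a by (simp add: of_nat_diff)
  \<comment> \<open>The sign of this difference decides the maximum; at
    \<open>k = (n - 1) * (a - 1)\<close> it is zero and both formulas agree.\<close>
  have BA: "int ?B - int ?A = (int n - 1) * (int a - 1) - int k"
    unfolding A B by (simp add: algebra_simps)
  have C: "int ((n - 1) * (a - 1)) = (int n - 1) * (int a - 1)"
    using assms(3) a by (simp add: of_nat_diff)
  \<comment> \<open>The summand \<open>n * m\<close> joins the bracket multiplied by
    \<open>m\<close>, and \<open>- n\<close> is the final term of both formulas.\<close>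
  have M: "int (n * (m - 1)) = int n * int m - int n"
    using assms(1) by (simp add: of_nat_diff algebra_simps)
  show ?thesis
  proof (intro conjI impI)
    show "graded_ideal (ideal_power mpol_ring J k)"
      unfolding H by (rule graded_monomial_ideal)
    show "krull_dim (mpol_ring Quot ideal_power mpol_ring J k) = 0"
      unfolding H by (rule krull_dim_power_exponents[OF assms(1,6)])
  next
    assume "k \<le> (n - 1) * (a - 1)"
    then have "?A \<le> ?B" using BA C by linarith
    then have "max ?A ?B = ?B" by (rule max_absorb2)
    then have "int (socle_degree (ideal_power mpol_ring J k)) = int m * int ?B + int (n * (m - 1))"
      unfolding s by simp
    then show "int (socle_degree (ideal_power mpol_ring J k))
          = int m * int a * (int k + int n - 1) - int n"
      unfolding B M by (simp add: algebra_simps)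
  next
    assume "k \<ge> (n - 1) * (a - 1)"
    then have "?B \<le> ?A" using BA C by linarith
    then have "max ?A ?B = ?A" by (rule max_absorb1)
    then have "int (socle_degree (ideal_power mpol_ring J k)) = int m * int ?A + int (n * (m - 1))"
      unfolding s by simp
    then show "int (socle_degree (ideal_power mpol_ring J k))
          = int m * (int a * int k + int k + int n - 1) - int n"
      unfolding A M by (simp add: algebra_simps)
  qed
qed

end
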